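(* There exists a nonzero bounded linear multiplicative operator $T:H^\infty\to H^\infty$ (that is, $T(fg)=T(f)T(g)$ for all $f,g\in H^\infty$) which is not a composition operator, i.e. there is no analytic map $\varphi:\mathbb{D}\to\mathbb{D}$ such that $Tf=f\circ\varphi$ for all $f\in H^\infty$.
   Context: $\mathbb{D}=\{z\in\mathbb{C}:|z|<1\}$. $H^\infty$ is the Banach algebra of bounded analytic functions on $\mathbb{D}$ with norm $\|f\|_\infty=\sup_{z\in\mathbb{D}}|f(z)|$ and pointwise multiplication. *)

theory Defs
  imports "HOL-Complex_Analysis.Complex_Analysis"
begin

abbreviation unit_disc :: "complex set" where
  "unit_disc \<equiv> ball 0 1"

text \<open>
  An element of \<open>H\<^sup>\<infinity>\<close> is a bounded holomorphic function on the open unit disc. HOL functions are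
  total, so each such function is represented by its extension by 0 to the whole plane;
  two elements are thus equal iff they agree on the disc.
\<close>

typedef hinf =
  "{f :: complex \<Rightarrow> complex. f holomorphic_on unit_disc \<and> bounded (f ` unit_disc) \<and>
     (\<forall>z. z \<notin> unit_disc \<longrightarrow> f z = 0)}"
  morphisms hinf_apply Abs_hinf
  by (rule exI[of _ "\<lambda>_. 0"]) (auto simp: image_constant_conv)

setup_lifting type_definition_hinf

lemma hinf_holomorphic: "hinf_apply f holomorphic_on unit_disc"
  using hinf_apply[of f] by simp

lemma hinf_bounded: "bounded (hinf_apply f ` unit_disc)"
  using hinf_apply[of f] by simp

lemma hinf_outside: "z \<notin> unit_disc \<Longrightarrow> hinf_apply f z = 0"
  using hinf_apply[of f] by blast

lemma hinf_eqI:
  assumes "\<And>z. z \<in> unit_disc \<Longrightarrow> hinf_apply f z = hinf_apply g z"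
  shows "f = g"
proof -
  have "hinf_apply f = hinf_apply g"
    by (rule ext) (metis assms hinf_outside)
  then show ?thesis
    by (simp add: hinf_apply_inject)
qed

lemma bounded_mult_image:
  fixes f g :: "'a \<Rightarrow> 'b::real_normed_algebra"
  assumes "bounded (f ` S)" "bounded (g ` S)"
  shows "bounded ((\<lambda>x. f x * g x) ` S)"
proof -
  obtain a b where ab: "\<And>x. x \<in> S \<Longrightarrow> norm (f x) \<le> a" "\<And>x. x \<in> S \<Longrightarrow> norm (g x) \<le> b"
    using assms unfolding bounded_iff by auto
  have "norm (f x * g x) \<le> a * b" if "x \<in> S" for x
  proof -
    have "norm (f x * g x) \<le> norm (f x) * norm (g x)"
      by (rule norm_mult_ineq)
    also have "\<dots> \<le> a * b"
      using ab[OF that] by (meson mult_mono norm_ge_zero order_trans)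
    finally show ?thesis .
  qed
  then show ?thesis
    unfolding bounded_iff by blast
qed

instantiation hinf :: comm_ring_1
begin

lift_definition zero_hinf :: hinf is "\<lambda>_. 0"
  by (auto simp: image_constant_conv)

lift_definition one_hinf :: hinf is "\<lambda>z. if z \<in> unit_disc then 1 else 0"
proof -
  have "(\<lambda>z. if z \<in> unit_disc then 1 else 0 :: complex) holomorphic_on unit_disc"
    by (rule holomorphic_transform[of "\<lambda>_. 1"]) auto
  moreover have "bounded ((\<lambda>z. if z \<in> unit_disc then 1 else 0 :: complex) ` unit_disc)"
    by (auto simp: bounded_iff intro!: exI[of _ 1])
  ultimately show "?thesis" by simp
qed

lift_definition plus_hinf :: "hinf \<Rightarrow> hinf \<Rightarrow> hinf" is "\<lambda>f g z. f z + g z"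
  by (auto intro!: holomorphic_intros bounded_plus_comp)

lift_definition minus_hinf :: "hinf \<Rightarrow> hinf \<Rightarrow> hinf" is "\<lambda>f g z. f z - g z"
  by (auto intro!: holomorphic_intros bounded_minus_comp)

lift_definition uminus_hinf :: "hinf \<Rightarrow> hinf" is "\<lambda>f z. - f z"
  by (auto intro!: holomorphic_intros simp: bounded_iff)

lift_definition times_hinf :: "hinf \<Rightarrow> hinf \<Rightarrow> hinf" is "\<lambda>f g z. f z * g z"
  by (auto intro!: holomorphic_intros bounded_mult_image)

instance
proof
  fix a b c :: hinf
  show "a * b * c = a * (b * c)" by transfer (simp add: mult.assoc)
  show "a * b = b * a" by transfer (simp add: mult.commute)
  show "1 * a = a" by transfer auto
  show "a + b + c = a + (b + c)" by transfer (simp add: add.assoc)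
  show "a + b = b + a" by transfer (simp add: add.commute)
  show "0 + a = a" by transfer simp
  show "- a + a = 0" by transfer simp
  show "a - b = a + - b" by transfer simp
  show "(a + b) * c = a * c + b * c" by transfer (simp add: algebra_simps)
  show "(0::hinf) \<noteq> 1" by transfer (auto simp: fun_eq_iff intro!: exI[of _ 0])
qed

end

text \<open>
  The type classes below provide only real scalar multiplication, so complex scalar
  multiplication is introduced separately.
\<close>

lift_definition scaleC_hinf :: "complex \<Rightarrow> hinf \<Rightarrow> hinf" is "\<lambda>c f z. c * f z"
  by (auto intro!: holomorphic_intros bounded_mult_image simp: image_constant_conv)

interpretation hinf: vector_space scaleC_hinf
proof
  fix a b :: complex and x y :: hinf
  show "scaleC_hinf a (x + y) = scaleC_hinf a x + scaleC_hinf a y"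
    by transfer (simp add: algebra_simps)
  show "scaleC_hinf (a + b) x = scaleC_hinf a x + scaleC_hinf b x"
    by transfer (simp add: algebra_simps)
  show "scaleC_hinf a (scaleC_hinf b x) = scaleC_hinf (a * b) x"
    by transfer (simp add: algebra_simps)
  show "scaleC_hinf 1 x = x"
    by transfer simp
qed

instantiation hinf :: real_normed_algebra_1
begin

definition scaleR_hinf :: "real \<Rightarrow> hinf \<Rightarrow> hinf" where
  "scaleR_hinf r f = scaleC_hinf (of_real r) f"

definition norm_hinf :: "hinf \<Rightarrow> real" where
  "norm_hinf f = (SUP z\<in>unit_disc. norm (hinf_apply f z))"

definition dist_hinf :: "hinf \<Rightarrow> hinf \<Rightarrow> real" where
  "dist_hinf f g = norm (f - g)"

definition sgn_hinf :: "hinf \<Rightarrow> hinf" where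
  "sgn_hinf f = scaleR (inverse (norm f)) f"

definition uniformity_hinf :: "(hinf \<times> hinf) filter" where
  "uniformity_hinf = (INF e\<in>{0 <..}. principal {(x, y). dist x y < e})"

definition open_hinf :: "hinf set \<Rightarrow> bool" where
  "open_hinf S = (\<forall>x\<in>S. \<forall>\<^sub>F (x', y) in uniformity. x' = x \<longrightarrow> y \<in> S)"

lemma norm_hinf_upper: "z \<in> unit_disc \<Longrightarrow> norm (hinf_apply f z) \<le> norm f"
  unfolding norm_hinf_def
  by (intro cSUP_upper bounded_imp_bdd_above) (auto intro: hinf_bounded simp: bounded_norm_comp)

lemma norm_hinf_least: "(\<And>z. z \<in> unit_disc \<Longrightarrow> norm (hinf_apply f z) \<le> b) \<Longrightarrow> norm f \<le> b"
  unfolding norm_hinf_def by (rule cSUP_least) auto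

instance
proof
  fix a b :: real and x y :: hinf
  show "a *\<^sub>R (x + y) = a *\<^sub>R x + a *\<^sub>R y"
    unfolding scaleR_hinf_def by (rule hinf.scale_right_distrib)
  show "(a + b) *\<^sub>R x = a *\<^sub>R x + b *\<^sub>R x"
    unfolding scaleR_hinf_def by (simp add: hinf.scale_left_distrib)
  show "a *\<^sub>R b *\<^sub>R x = (a * b) *\<^sub>R x"
    unfolding scaleR_hinf_def by simp
  show "1 *\<^sub>R x = x"
    unfolding scaleR_hinf_def by simp
  show "a *\<^sub>R x * y = a *\<^sub>R (x * y)"
    unfolding scaleR_hinf_def by transfer (simp add: algebra_simps)
  show "x * a *\<^sub>R y = a *\<^sub>R (x * y)"
    unfolding scaleR_hinf_def by transfer (simp add: algebra_simps)
  show "dist x y = norm (x - y)"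
    by (rule dist_hinf_def)
  show "sgn x = inverse (norm x) *\<^sub>R x"
    by (rule sgn_hinf_def)
  show "uniformity = (INF e\<in>{0 <..}. principal {(x::hinf, y). dist x y < e})"
    by (rule uniformity_hinf_def)
  show "open U = (\<forall>x\<in>U. \<forall>\<^sub>F (x', y) in uniformity. x' = x \<longrightarrow> y \<in> U)" for U :: "hinf set"
    by (rule open_hinf_def)
  show "norm (x + y) \<le> norm x + norm y"
  proof (rule norm_hinf_least)
    fix z :: complex assume "z \<in> unit_disc"
    then show "norm (hinf_apply (x + y) z) \<le> norm x + norm y"
      using norm_hinf_upper[of z x] norm_hinf_upper[of z y]
        norm_triangle_ineq[of "hinf_apply x z" "hinf_apply y z"]
      by (simp add: plus_hinf.rep_eq)
  qed
  show "norm (x * y) \<le> norm x * norm y"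
  proof (rule norm_hinf_least)
    fix z :: complex assume z: "z \<in> unit_disc"
    then show "norm (hinf_apply (x * y) z) \<le> norm x * norm y"
      using mult_mono[OF norm_hinf_upper[OF z, of x] norm_hinf_upper[OF z, of y]]
        order_trans[OF norm_ge_zero norm_hinf_upper[OF z, of x]]
      by (simp add: times_hinf.rep_eq norm_mult)
  qed
  show "norm (1::hinf) = 1"
    unfolding norm_hinf_def by (simp add: one_hinf.rep_eq)
  show "norm x = 0 \<longleftrightarrow> x = 0"
  proof
    assume "norm x = 0"
    then have "hinf_apply x z = hinf_apply 0 z" if "z \<in> unit_disc" for z
      using norm_hinf_upper[OF that, of x] by (simp add: zero_hinf.rep_eq)
    then show "x = 0" by (rule hinf_eqI)
  qed (simp add: norm_hinf_def zero_hinf.rep_eq)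
  have le: "norm (c *\<^sub>R u) \<le> \<bar>c\<bar> * norm u" for c :: real and u :: hinf
  proof (rule norm_hinf_least)
    fix z :: complex assume "z \<in> unit_disc"
    then show "norm (hinf_apply (c *\<^sub>R u) z) \<le> \<bar>c\<bar> * norm u"
      unfolding scaleR_hinf_def scaleC_hinf.rep_eq norm_mult
      using norm_hinf_upper[of z u] by (simp add: mult_left_mono)
  qed
  show "norm (a *\<^sub>R x) = \<bar>a\<bar> * norm x"
  proof (cases "a = 0")
    case True
    then show ?thesis
      by (simp add: scaleR_hinf_def norm_hinf_def zero_hinf.rep_eq)
  next
    case False
    have "inverse a *\<^sub>R a *\<^sub>R x = x"
      unfolding scaleR_hinf_def using False by (simp flip: of_real_mult)
    then have "norm x \<le> \<bar>inverse a\<bar> * norm (a *\<^sub>R x)"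
      using le[of "inverse a" "a *\<^sub>R x"] by simp
    then have "\<bar>a\<bar> * norm x \<le> norm (a *\<^sub>R x)"
      using False by (simp add: field_simps)
    with le[of a x] show ?thesis by simp
  qed
qed

end

lemma norm_scaleC_hinf: "norm (scaleC_hinf c f) = norm c * norm f"
proof -
  have le: "norm (scaleC_hinf d u) \<le> norm d * norm u" for d and u :: hinf
    by (rule norm_hinf_least)
      (simp add: scaleC_hinf.rep_eq norm_mult mult_left_mono norm_hinf_upper)
  show ?thesis
  proof (cases "c = 0")
    case False
    then have "norm f \<le> norm (inverse c) * norm (scaleC_hinf c f)"
      using le[of "inverse c" "scaleC_hinf c f"] by simp
    then have "norm c * norm f \<le> norm (scaleC_hinf c f)"
      using False unfolding norm_inverse by (simp add: inverse_eq_divide pos_le_divide_eq mult.commute)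
    with le[of c f] show ?thesis by simp
  qed simp
qed

instance hinf :: banach
proof
  fix X :: "nat \<Rightarrow> hinf"
  assume X: "Cauchy X"
  have "uniformly_Cauchy_on unit_disc (\<lambda>n. hinf_apply (X n))"
    unfolding uniformly_Cauchy_on_def
  proof (intro allI impI)
    fix e :: real assume "e > 0"
    then obtain M where M: "\<And>m n. m \<ge> M \<Longrightarrow> n \<ge> M \<Longrightarrow> norm (X m - X n) < e"
      using X unfolding Cauchy_def dist_norm by blast
    have "dist (hinf_apply (X m) z) (hinf_apply (X n) z) < e"
      if "z \<in> unit_disc" "m \<ge> M" "n \<ge> M" for z m n
      using norm_hinf_upper[OF that(1), of "X m - X n"] M[OF that(2,3)]
      by (simp add: minus_hinf.rep_eq dist_norm)
    then show "\<exists>M. \<forall>x\<in>unit_disc. \<forall>m\<ge>M. \<forall>n\<ge>M. dist (hinf_apply (X m) x) (hinf_apply (X n) x) < e"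
      by blast
  qed
  then obtain l where l: "uniform_limit unit_disc (\<lambda>n. hinf_apply (X n)) l sequentially"
    using Cauchy_uniformly_convergent unfolding uniformly_convergent_on_def by blast
  define g where "g = (\<lambda>z. if z \<in> unit_disc then l z else 0)"
  have ev: "\<forall>\<^sub>F n in sequentially. \<forall>z\<in>unit_disc. dist (hinf_apply (X n) z) (l z) < e"
    if "e > 0" for e :: real
    using l that unfolding uniform_limit_iff by blast
  have "l holomorphic_on unit_disc"
  proof (rule holomorphic_uniform_sequence)
    show "hinf_apply (X n) holomorphic_on unit_disc" for n
      by (rule hinf_holomorphic)
    fix x :: complex assume "x \<in> unit_disc"
    then obtain d where "d > 0" "cball x d \<subseteq> unit_disc"
      using open_contains_cball[of unit_disc] open_ball by blast
    then show "\<exists>d>0. cball x d \<subseteq> unit_disc \<and>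
        uniform_limit (cball x d) (\<lambda>n. hinf_apply (X n)) l sequentially"
      using uniform_limit_on_subset[OF l] by blast
  qed auto
  then have hol: "g holomorphic_on unit_disc"
    by (rule holomorphic_transform) (simp add: g_def)
  obtain N where N: "\<And>z. z \<in> unit_disc \<Longrightarrow> dist (hinf_apply (X N) z) (l z) < 1"
    using ev[OF zero_less_one] unfolding eventually_sequentially by (meson order_refl)
  have "norm (g z) \<le> norm (X N) + 1" if "z \<in> unit_disc" for z
  proof -
    have "norm (l z) \<le> norm (hinf_apply (X N) z) + norm (l z - hinf_apply (X N) z)"
      by (rule norm_triangle_sub)
    also have "\<dots> \<le> norm (X N) + 1"
      using N[OF that] norm_hinf_upper[OF that, of "X N"]
      by (intro add_mono) (simp_all add: dist_norm norm_minus_commute)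
    finally show ?thesis using that by (simp add: g_def)
  qed
  then have "bounded (g ` unit_disc)"
    unfolding bounded_iff by blast
  with hol have "hinf_apply (Abs_hinf g) = g"
    by (intro Abs_hinf_inverse) (simp add: g_def)
  then obtain G where G: "hinf_apply G = g"
    by blast
  have "X \<longlonglongrightarrow> G"
  proof (rule tendstoI)
    fix e :: real assume "e > 0"
    have "dist (X n) G < e"
      if n: "\<forall>z\<in>unit_disc. dist (hinf_apply (X n) z) (l z) < e / 2" for n
    proof -
      have "norm (X n - G) \<le> e / 2"
      proof (rule norm_hinf_least)
        fix z :: complex assume "z \<in> unit_disc"
        moreover from this have "dist (hinf_apply (X n) z) (l z) < e / 2"
          using n by blast
        ultimately show "norm (hinf_apply (X n - G) z) \<le> e / 2"
          by (simp add: minus_hinf.rep_eq G g_def dist_norm)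
      qed
      with \<open>e > 0\<close> show ?thesis by (simp add: dist_norm)
    qed
    then show "\<forall>\<^sub>F n in sequentially. dist (X n) G < e"
      using eventually_mono[OF ev[of "e / 2"]] \<open>e > 0\<close> by simp
  qed
  then show "convergent X"
    by (rule convergentI)
qed

end

theory Submission
  imports Defs
begin

text \<open>
  The multiplicative functionals of norm at most 1 on \<open>H\<^sup>\<infinity>\<close> form a weak* compact set, so
  their values at the coordinate function \<open>z\<close> form a compact subset of the plane. It contains the
  open disc (point evaluations), hence also the boundary point 1. If \<open>\<psi>(z) = 1\<close>, then
  \<open>f \<mapsto> \<psi>(f) \<cdot> 1\<close> is multiplicative, but it could only be composition with the constant 1,
  which is not a self-map of the disc.
\<close>

definition characters :: "(hinf \<Rightarrow> complex) set" where
  "characters = {\<psi>. (\<forall>f. norm (\<psi> f) \<le> norm f) \<and> (\<forall>f g. \<psi> (f + g) = \<psi> f + \<psi> g) \<and>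
     (\<forall>c f. \<psi> (scaleC_hinf c f) = c * \<psi> f) \<and> (\<forall>f g. \<psi> (f * g) = \<psi> f * \<psi> g)}"

text \<open>This is the Banach-Alaoglu argument. The type \<open>hinf \<Rightarrow> complex\<close>
  carries the topology of pointwise convergence, so Tychonoff makes a product of closed discs
  compact. For fixed arguments, each algebraic identity equates two continuous functions of
  \<open>\<psi>\<close>, hence cuts out a closed set.\<close>

lemma compact_characters: "compact characters"
proof -
  \<comment> \<open>With index set \<open>UNIV\<close>, \<open>PiE\<close> imposes no
    \<open>undefined\<close> values: this is the set of all maps obeying the norm bound.\<close>
  let ?K = "PiE UNIV (\<lambda>f::hinf. cball (0::complex) (norm f))"
  have "compact ?K"
    using compactin_PiE[of "\<lambda>_::hinf. euclidean :: complex topology" UNIV "\<lambda>f. cball 0 (norm f)"]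
    by (simp add: euclidean_product_topology)
  moreover have ev: "continuous_on UNIV (\<lambda>\<psi>::hinf \<Rightarrow> complex. \<psi> f)" for f
    by (rule continuous_on_product_coordinates)
  have "closed {\<psi>::hinf \<Rightarrow> complex. (\<forall>f g. \<psi> (f + g) = \<psi> f + \<psi> g) \<and>
     (\<forall>c f. \<psi> (scaleC_hinf c f) = c * \<psi> f) \<and> (\<forall>f g. \<psi> (f * g) = \<psi> f * \<psi> g)}"
    by (intro closed_Collect_conj closed_Collect_all closed_Collect_eq continuous_intros ev)
  ultimately have "compact (?K \<inter> {\<psi>::hinf \<Rightarrow> complex. (\<forall>f g. \<psi> (f + g) = \<psi> f + \<psi> g) \<and>
     (\<forall>c f. \<psi> (scaleC_hinf c f) = c * \<psi> f) \<and> (\<forall>f g. \<psi> (f * g) = \<psi> f * \<psi> g)})"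
    by (rule compact_Int_closed)
  also have "\<dots> = characters"
    by (auto simp: characters_def PiE_def Pi_def)
  finally show ?thesis .
qed

lemma point_evaluation_character:
  "z \<in> unit_disc \<Longrightarrow> (\<lambda>f. hinf_apply f z) \<in> characters"
  by (auto simp: characters_def plus_hinf.rep_eq times_hinf.rep_eq scaleC_hinf.rep_eq
      intro: norm_hinf_upper)

text \<open>The identity function, cut off to 0 outside the disc as the type demands. The value of a
  character here tells over which point of the closed disc it lies.\<close>

lift_definition coord_hinf :: hinf is "\<lambda>z. if z \<in> unit_disc then z else 0"
proof -
  have "(\<lambda>z. if z \<in> unit_disc then z else 0 :: complex) holomorphic_on unit_disc"
    by (rule holomorphic_transform[of "\<lambda>z. z"]) auto
  moreover have "bounded ((\<lambda>z. if z \<in> unit_disc then z else 0 :: complex) ` unit_disc)"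
    by (auto simp: bounded_iff intro!: exI[of _ 1])
  ultimately show "?thesis" by simp
qed

text \<open>For w on the unit circle no point evaluation in the disc will do. Existence is
  nonconstructive: a continuous image of a compact set is closed, so containing the open disc forces
  it to contain the closure.\<close>

lemma character_over_closed_disc:
  assumes "w \<in> cball 0 1"
  obtains \<psi> where "\<psi> \<in> characters" "\<psi> coord_hinf = w"
proof -
  have "continuous_on characters (\<lambda>\<psi>. \<psi> coord_hinf)"
    by (rule continuous_on_subset[OF continuous_on_product_coordinates]) simp
  then have "closed ((\<lambda>\<psi>. \<psi> coord_hinf) ` characters)"
    by (intro compact_imp_closed compact_continuous_image compact_characters)
  moreover have "unit_disc \<subseteq> (\<lambda>\<psi>. \<psi> coord_hinf) ` characters"
  proof
    fix z :: complex assume z: "z \<in> unit_disc"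
    then have "z = hinf_apply coord_hinf z"
      by (simp add: coord_hinf.rep_eq)
    then show "z \<in> (\<lambda>\<psi>. \<psi> coord_hinf) ` characters"
      using point_evaluation_character[OF z]
      by (intro image_eqI[where x = "\<lambda>f. hinf_apply f z"])
  qed
  ultimately have "closure unit_disc \<subseteq> (\<lambda>\<psi>. \<psi> coord_hinf) ` characters"
    by (rule closure_minimal[rotated])
  with assms that show thesis by auto
qed

theorem theorem2p1:
  shows "\<exists>T :: hinf \<Rightarrow> hinf.
    bounded_linear T \<and> Vector_Spaces.linear scaleC_hinf scaleC_hinf T \<and>
    (\<forall>f g. T (f * g) = T f * T g) \<and>
    T \<noteq> (\<lambda>_. 0) \<and>
    \<not> (\<exists>\<phi> :: complex \<Rightarrow> complex. \<phi> holomorphic_on unit_disc \<and> \<phi> ` unit_disc \<subseteq> unit_disc \<and>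
        (\<forall>f. \<forall>z\<in>unit_disc. hinf_apply (T f) z = (hinf_apply f \<circ> \<phi>) z))"
proof -
  obtain \<psi> where \<psi>: "\<psi> \<in> characters" and \<psi>1: "\<psi> coord_hinf = 1"
    by (rule character_over_closed_disc[of 1]) simp_all
  have bound: "norm (\<psi> f) \<le> norm f" and add: "\<psi> (f + g) = \<psi> f + \<psi> g"
    and scale: "\<psi> (scaleC_hinf c f) = c * \<psi> f" and mult: "\<psi> (f * g) = \<psi> f * \<psi> g" for f g c
    using \<psi> by (auto simp: characters_def)
  \<comment> \<open>\<open>1\<close> is the unit of \<open>hinf\<close>, so \<open>T f\<close> is a
    constant function and inherits multiplicativity from \<open>\<psi>\<close>.\<close>
  define T where "T f = scaleC_hinf (\<psi> f) 1" for f
  have T_apply: "hinf_apply (T f) z = \<psi> f" if "z \<in> unit_disc" for f z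
    using that by (simp add: T_def scaleC_hinf.rep_eq one_hinf.rep_eq)
  have lin: "Vector_Spaces.linear scaleC_hinf scaleC_hinf T"
    by unfold_locales (simp_all add: T_def add scale hinf.scale_left_distrib)
  have "bounded_linear T"
  \<comment> \<open>The constant 1 suffices since the unit of \<open>hinf\<close> has norm 1 and
    \<open>\<psi>\<close> does not increase norms.\<close>
  proof (rule bounded_linear_intro[where K = 1])
    show "T (f + g) = T f + T g" for f g
      by (simp add: T_def add hinf.scale_left_distrib)
    show "T (r *\<^sub>R f) = r *\<^sub>R T f" for r f
      by (simp add: T_def scaleR_hinf_def scale)
    show "norm (T f) \<le> norm f * 1" for f
      by (simp add: T_def norm_scaleC_hinf bound)
  qed
  moreover have "T (f * g) = T f * T g" for f g
    by (rule hinf_eqI) (simp add: T_apply times_hinf.rep_eq mult)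
  moreover have T_coord: "hinf_apply (T coord_hinf) 0 = 1"
    by (simp add: T_apply \<psi>1)
  then have "T \<noteq> (\<lambda>_. 0)"
    by (auto simp: zero_hinf.rep_eq)
  moreover have False
    if maps: "\<phi> ` unit_disc \<subseteq> unit_disc"
      and comp: "\<forall>f. \<forall>z\<in>unit_disc. hinf_apply (T f) z = (hinf_apply f \<circ> \<phi>) z" for \<phi>
  proof -
    have "\<phi> 0 \<in> unit_disc"
      using maps by (auto simp: image_subset_iff)
    moreover have "hinf_apply coord_hinf (\<phi> 0) = 1"
      using comp[rule_format, of 0 coord_hinf] T_coord by simp
    \<comment> \<open>On the disc \<open>coord_hinf\<close> is the identity, so
      \<open>\<phi> 0 = 1\<close>, although \<open>\<phi> 0\<close> has modulus below 1.\<close>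
    ultimately show False
      by (simp add: coord_hinf.rep_eq)
  qed
  ultimately show ?thesis
    using lin by blast
qed

end
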